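(* Let $A_o,A_i\in\mathbb R^{n_y\times n_x}$, let $B_o,B_i\in\mathbb R^{n_y\times n_y}$ and $C_o,C_i\in\mathbb R^{n_x\times n_x}$ be invertible, and suppose the inclusion $y\in\{(A_o+B_o\Delta C_o)x:\|\Delta\|\le1\}$ contains the inclusion $y\in\{(A_i+B_i\Delta C_i)x:\|\Delta\|\le1\}$. Let $W_o=(\det(B_oB_o^T))^{1/(2n_y)}\|C_o\|_{\mathrm F}$ and $W_i=(\det(B_iB_i^T))^{1/(2n_y)}\|C_i\|_{\mathrm F}$. If $W_o=W_i$, then $A_o=A_i$ and there exists $\lambda>0$ such that $\lambda B_oB_o^T=B_iB_i^T$ and $C_o^TC_o=\lambda C_i^TC_i$.
   Context: $\|\cdot\|$ is the spectral norm, $\|\cdot\|_{\mathrm F}$ the Frobenius norm. An inclusion contains another if every pair $(x,y)\in\mathbb C^{n_x}\times\mathbb C^{n_y}$ satisfying the second also satisfies the first. *)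

theory Defs
  imports "HOL-Analysis.Analysis"
begin

text \<open>Complexification of a real matrix (entrywise embedding).\<close>
definition cmat :: "real ^ 'n ^ 'm \<Rightarrow> complex ^ 'n ^ 'm" where
  "cmat A = (\<chi> i j. complex_of_real (A $ i $ j))"

text \<open>Spectral norm of a complex matrix: operator norm w.r.t. the Euclidean norms.\<close>
definition spec_norm :: "complex ^ 'n ^ 'm \<Rightarrow> real" where
  "spec_norm D = onorm (\<lambda>v. D *v v)"

text \<open>Frobenius norm of a real matrix.\<close>
definition frob_norm :: "real ^ 'n ^ 'm \<Rightarrow> real" where
  "frob_norm C = sqrt (\<Sum>i\<in>UNIV. \<Sum>j\<in>UNIV. (C $ i $ j)\<^sup>2)"

text \<open>The inclusion y \<in> {(A + B \<Delta> C) x : \<parallel>\<Delta>\<parallel> \<le> 1}, as a set of complex pairs (x,y).\<close>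
definition incl :: "real ^ 'nx ^ 'ny \<Rightarrow> real ^ 'ny ^ 'ny \<Rightarrow> real ^ 'nx ^ 'nx
    \<Rightarrow> ((complex ^ 'nx) \<times> (complex ^ 'ny)) set" where
  "incl A B C = {(x, y). \<exists>D :: complex ^ 'nx ^ 'ny. spec_norm D \<le> 1 \<and>
      y = (cmat A + cmat B ** D ** cmat C) *v x}"

end

theory Submission
  imports Defs
begin

(* Testing the inclusion on real pairs (x, y) with rank-one contractions \<Delta> shows that, for
   M = Bo\<^sup>-\<^sup>1 Bi and N = Bo\<^sup>-\<^sup>1 (Ai - Ao), the affine map u \<mapsto> M u + N x sends the ball of radius
   |Ci x| into the ball of radius |Co x|. Comparing volumes gives g |Ci x| \<le> |Co x| with
   g = |det M|^(1/ny), so Co\<^sup>T Co - g\<^sup>2 Ci\<^sup>T Ci is positive semidefinite; equal weights say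
   precisely that its trace |Co|_F\<^sup>2 - g\<^sup>2 |Ci|_F\<^sup>2 vanishes, so it is zero. Now each affine
   image of a ball is a closed subset of a ball of the same volume, hence the whole ball,
   which forces N = 0 and M to be g times an isometry, i.e. Bi Bi\<^sup>T = g\<^sup>2 Bo Bo\<^sup>T. *)

section \<open>Reduction to real affine maps\<close>

definition cvec :: "real ^ 'n \<Rightarrow> complex ^ 'n" where
  "cvec x = (\<chi> i. complex_of_real (x $ i))"

lemma norm_cvec [simp]: "norm (cvec x) = norm x"
  by (simp add: cvec_def norm_vec_def)

lemma cvec_add: "cvec (x + y) = cvec x + cvec y"
  by (simp add: cvec_def vec_eq_iff)

lemma cvec_diff: "cvec (x - y) = cvec x - cvec y"
  by (simp add: cvec_def vec_eq_iff)

lemma cmat_matrix_vector_mult_cvec: "cmat A *v cvec x = cvec (A *v x)"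
  by (simp add: cmat_def cvec_def matrix_vector_mult_def vec_eq_iff)

lemma cmat_matrix_mult: "cmat A ** cmat B = cmat (A ** B)"
  by (simp add: cmat_def matrix_matrix_mult_def vec_eq_iff)

lemma cmat_mat_1: "cmat (mat 1) = mat 1"
  by (simp add: cmat_def mat_def vec_eq_iff)

lemma norm_matrix_vector_mult_le_spec_norm:
  fixes D :: "complex ^ 'n ^ 'm"
  shows "norm (D *v v) \<le> spec_norm D * norm v"
  unfolding spec_norm_def by (rule onorm) (simp add: linear_conv_bounded_linear)

lemma contraction_mapping_exists:
  fixes y :: "real ^ 'n" and u :: "real ^ 'm"
  assumes u: "norm u \<le> norm y"
  obtains D :: "complex ^ 'n ^ 'm" where "spec_norm D \<le> 1" and "D *v cvec y = cvec u"
proof (cases "y = 0")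
  case True
  with u have "u = 0" by simp
  with True that[of 0] show ?thesis
    by (simp add: spec_norm_def onorm_zero cvec_def vec_eq_iff)
next
  case False
  then have ny: "norm y > 0" by simp
  define N :: "real ^ 'n ^ 'm" where "N = (\<chi> a b. u $ a * y $ b / (norm y)\<^sup>2)"
  define D where "D = cmat N"
  have "(\<Sum>b\<in>UNIV. N $ a $ b * y $ b) = u $ a" for a
  proof -
    have "(\<Sum>b\<in>UNIV. N $ a $ b * y $ b) = u $ a / (norm y)\<^sup>2 * (y \<bullet> y)"
      by (simp add: N_def inner_vec_def sum_distrib_left sum_divide_distrib mult_ac)
    then show ?thesis
      using ny by (simp add: power2_norm_eq_inner[symmetric])
  qed
  then have "N *v y = u"
    by (simp add: matrix_vector_mult_def vec_eq_iff)
  then have "D *v cvec y = cvec u"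
    by (simp add: D_def cmat_matrix_vector_mult_cvec)
  moreover have "spec_norm D \<le> 1"
    unfolding spec_norm_def
  proof (rule onorm_le)
    fix v :: "complex ^ 'n"
    define s where "s = (\<Sum>b\<in>UNIV. complex_of_real (y $ b) * v $ b)"
    have "norm s \<le> (\<Sum>b\<in>UNIV. \<bar>y $ b\<bar> * \<bar>norm (v $ b)\<bar>)"
      unfolding s_def by (rule order_trans[OF norm_sum]) (simp add: norm_mult)
    also have "\<dots> \<le> L2_set (\<lambda>b. y $ b) UNIV * L2_set (\<lambda>b. norm (v $ b)) UNIV"
      by (rule L2_set_mult_ineq)
    finally have s: "norm s \<le> norm y * norm v"
      by (simp add: norm_vec_def L2_set_def)
    define c where "c = s / complex_of_real ((norm y)\<^sup>2)"
    have "D *v v = (\<chi> a. c * cvec u $ a)"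
      by (simp add: D_def N_def c_def cmat_def cvec_def matrix_vector_mult_def vec_eq_iff s_def
          sum_divide_distrib sum_distrib_left mult_ac)
    then have "norm (D *v v) = norm c * norm u"
      by (simp add: norm_vec_def norm_mult L2_set_right_distrib cvec_def)
    also have "\<dots> = norm s / (norm y)\<^sup>2 * norm u"
      by (simp add: c_def norm_divide norm_power)
    also have "\<dots> \<le> (norm y * norm v) / (norm y)\<^sup>2 * norm y"
      by (intro mult_mono divide_right_mono s u) auto
    also have "\<dots> = 1 * norm v"
      using ny by (simp add: power2_eq_square)
    finally show "norm (D *v v) \<le> 1 * norm v" .
  qed
  ultimately show ?thesis
    using that by blast
qed

lemma incl_subset_imp_real_affine_bound:
  fixes Ai Ao :: "real ^ 'nx ^ 'ny" and Bi Bo P :: "real ^ 'ny ^ 'ny" and Ci Co :: "real ^ 'nx ^ 'nx"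
  assumes sub: "incl Ai Bi Ci \<subseteq> incl Ao Bo Co" and P: "P ** Bo = mat 1"
    and u: "norm u \<le> norm (Ci *v x)"
  shows "norm ((P ** Bi) *v u + (P ** (Ai - Ao)) *v x) \<le> norm (Co *v x)"
proof -
  obtain D where D: "spec_norm D \<le> 1" "D *v cvec (Ci *v x) = cvec u"
    using contraction_mapping_exists[OF u] .
  have "(cmat Ai + cmat Bi ** D ** cmat Ci) *v cvec x = cvec (Ai *v x + Bi *v u)"
    by (simp add: matrix_vector_mult_add_rdistrib matrix_vector_mul_assoc[symmetric]
        cmat_matrix_vector_mult_cvec D cvec_add)
  then have "(cvec x, cvec (Ai *v x + Bi *v u)) \<in> incl Ai Bi Ci"
    unfolding incl_def using D by force
  with sub obtain D' :: "complex ^ 'nx ^ 'ny" where D': "spec_norm D' \<le> 1"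
    and eq: "cvec (Ai *v x + Bi *v u) = (cmat Ao + cmat Bo ** D' ** cmat Co) *v cvec x"
    unfolding incl_def by blast
  define w where "w = D' *v cvec (Co *v x)"
  have "cvec (Ai *v x + Bi *v u) = cvec (Ao *v x) + cmat Bo *v w"
    using eq by (simp add: w_def matrix_vector_mult_add_rdistrib matrix_vector_mul_assoc[symmetric]
        cmat_matrix_vector_mult_cvec)
  then have "cmat Bo *v w = cvec (Ai *v x + Bi *v u - Ao *v x)"
    by (simp add: cvec_diff)
  then have "w = cvec (P *v (Ai *v x + Bi *v u - Ao *v x))"
    by (metis P cmat_mat_1 cmat_matrix_mult cmat_matrix_vector_mult_cvec matrix_vector_mul_assoc
        matrix_vector_mul_lid)
  also have "P *v (Ai *v x + Bi *v u - Ao *v x) = (P ** Bi) *v u + (P ** (Ai - Ao)) *v x"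
    by (simp add: matrix_vector_mul_assoc[symmetric] algebra_simps)
  finally have "w = cvec ((P ** Bi) *v u + (P ** (Ai - Ao)) *v x)" .
  moreover have "norm w \<le> spec_norm D' * norm (Co *v x)"
    unfolding w_def using norm_matrix_vector_mult_le_spec_norm[of D' "cvec (Co *v x)"] by simp
  then have "norm w \<le> norm (Co *v x)"
    using mult_right_mono[OF D' norm_ge_zero, of "Co *v x"] by simp
  ultimately show ?thesis
    by simp
qed

section \<open>Volumes of linear images\<close>

lemma measure_shear_cbox:
  fixes a b :: "real ^ 'n"
  assumes "m \<noteq> n"
  shows "measure lebesgue ((\<lambda>x. \<chi> i. if i = m then x $ m + x $ n else x $ i) ` cbox a b)
       = measure lebesgue (cbox a b)"
proof (cases "cbox a b = {}")
  case False
  let ?h = "\<lambda>x::real ^ 'n. \<chi> i. if i = m then x $ m + x $ n else x $ i"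
  have box: "cbox a b = (+) a ` cbox 0 (b - a)"
    using cbox_translation[of a 0 "b - a"] by simp
  have "?h ` cbox a b = (+) (?h a) ` ?h ` cbox 0 (b - a)"
    unfolding box image_image by (intro image_cong) (auto simp: vec_eq_iff)
  then have "measure lebesgue (?h ` cbox a b) = measure lebesgue (?h ` cbox 0 (b - a))"
    by (simp only: measure_translation)
  also have "\<dots> = measure lebesgue (cbox 0 (b - a))"
    using False assms by (intro measure_shear_interval) (auto simp: box)
  also have "\<dots> = measure lebesgue (cbox a b)"
    unfolding box by (rule measure_translation[symmetric])
  finally show ?thesis .
qed simp

lemma measure_swap_cbox:
  fixes a b :: "real ^ 'n"
  shows "measure lebesgue ((\<lambda>x. \<chi> i. x $ Transposition.transpose m n i) ` cbox a b)
       = measure lebesgue (cbox a b)"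
proof (cases "cbox a b = {}")
  case False
  let ?s = "Transposition.transpose m n"
  let ?h = "\<lambda>x::real ^ 'n. \<chi> i. x $ ?s i"
  have img: "?h ` cbox a b = cbox (?h a) (?h b)"
    by (auto simp: image_iff lambda_swap_Galois mem_box_cart) (metis transpose_involutory)+
  with False have "cbox (?h a) (?h b) \<noteq> {}" by auto
  moreover have "(\<Prod>i\<in>UNIV. (b - a) $ ?s i) = (\<Prod>i\<in>UNIV. (b - a) $ i)"
    using prod.permute[OF permutes_swap_id[of m UNIV n], of "\<lambda>i. (b - a) $ i"] by (simp add: o_def)
  ultimately show ?thesis
    using False by (simp add: img content_cbox_cart)
qed simp

lemma measure_matrix_image_if_cbox:
  fixes A :: "real ^ 'n ^ 'n"
  assumes "\<And>a b. measure lebesgue ((*v) A ` cbox a b) = \<bar>det A\<bar> * measure lebesgue (cbox a b)"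
  shows "\<forall>S \<in> lmeasurable. (*v) A ` S \<in> lmeasurable \<and>
           measure lebesgue ((*v) A ` S) = \<bar>det A\<bar> * measure lebesgue S"
proof
  fix S :: "(real ^ 'n) set"
  assume "S \<in> lmeasurable"
  from measure_linear_sufficient[OF matrix_vector_mul_linear this assms]
  show "(*v) A ` S \<in> lmeasurable \<and> measure lebesgue ((*v) A ` S) = \<bar>det A\<bar> * measure lebesgue S"
    by simp
qed

(* Change_Of_Vars.measure_linear_image needs a well-ordered index type, which only its shear
   case uses; measure_shear_cbox avoids it. *)
lemma measure_matrix_image:
  fixes A :: "real ^ 'n ^ 'n"
  assumes "S \<in> lmeasurable"
  shows "(*v) A ` S \<in> lmeasurable \<and>
         measure lebesgue ((*v) A ` S) = \<bar>det A\<bar> * measure lebesgue S"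
proof -
  have "\<forall>S \<in> lmeasurable. (*v) A ` S \<in> lmeasurable \<and>
          measure lebesgue ((*v) A ` S) = \<bar>det A\<bar> * measure lebesgue S"
  proof (induction A rule: induct_matrix_elementary_alt[case_names mult zero_row diagonal swap1 idplus])
    case (mult A B)
    have "(*v) (A ** B) ` S = (*v) A ` ((*v) B ` S)" for S
      by (simp add: image_image matrix_vector_mul_assoc)
    with mult show ?case
      by (simp add: det_mul abs_mult)
  next
    case (zero_row A i)
    then have "det A = 0" by (rule det_zero_row)
    then have "\<not> inj ((*v) A)"
      using det_nz_iff_inj[of "(*v) A"] by simp
    then have "negligible ((*v) A ` S)" for S
      by (intro negligible_linear_singular_image) simp_all
    then show ?case
      by (simp add: \<open>det A = 0\<close> negligible_imp_measurable negligible_imp_measure0)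
  next
    case (diagonal A)
    then have "(\<Sum>j\<in>UNIV. A $ i $ j * x $ j) = A $ i $ i * x $ i" for i x
      by (subst sum.remove[of UNIV i]) (auto intro: sum.neutral)
    then have "(*v) A = (\<lambda>x. \<chi> i. A $ i $ i * x $ i)"
      by (simp add: fun_eq_iff vec_eq_iff matrix_vector_mult_def)
    then show ?case
      using diagonal by (simp add: measurable_stretch measure_stretch det_diagonal)
  next
    case (swap1 m n)
    let ?A = "\<chi> i j. mat 1 $ i $ Transposition.transpose m n j :: real ^ 'n ^ 'n"
    have "(\<Sum>j\<in>UNIV. ?A $ i $ j * x $ j) = x $ Transposition.transpose m n i" for i x
      by (subst sum.remove[of UNIV "Transposition.transpose m n i"])
        (auto simp: mat_def split: if_splits intro!: sum.neutral)
    then have "(*v) ?A = (\<lambda>x. \<chi> i. x $ Transposition.transpose m n i)"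
      by (simp add: fun_eq_iff vec_eq_iff matrix_vector_mult_def)
    moreover have "\<bar>det ?A\<bar> = 1"
      by (simp add: det_permute_columns permutes_swap_id sign_swap_id)
    ultimately show ?case
      by (intro measure_matrix_image_if_cbox) (simp add: measure_swap_cbox)
  next
    case (idplus m n)
    let ?A = "\<chi> i j. of_bool (i = m \<and> j = n \<or> i = j) :: real ^ 'n ^ 'n"
    have "(\<Sum>j\<in>UNIV. ?A $ i $ j * x $ j) = (if i = m then x $ m + x $ n else x $ i)" for i x
      using idplus
      by (subst sum.remove[of UNIV i]) (auto simp: sum.remove[of "UNIV - {m}" n] intro!: sum.neutral)
    then have "(*v) ?A = (\<lambda>x. \<chi> i. if i = m then x $ m + x $ n else x $ i)"
      by (simp add: fun_eq_iff vec_eq_iff matrix_vector_mult_def)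
    moreover have "?A = (\<chi> k. if k = m then row m (mat 1) + 1 *s row n (mat 1) else row k (mat 1))"
      using idplus by (auto simp: vec_eq_iff row_def mat_def)
    then have "det ?A = 1"
      using det_row_operation[OF idplus, of "mat 1" 1] by simp
    ultimately show ?case
      using idplus by (intro measure_matrix_image_if_cbox) (simp add: measure_shear_cbox)
  qed
  with assms show ?thesis by blast
qed

lemma abs_det_le_if_cball_image_subset:
  fixes M :: "real ^ 'n ^ 'n"
  assumes "r \<ge> 0" and "R \<ge> 0" and bound: "\<And>u. norm u \<le> r \<Longrightarrow> norm (M *v u) \<le> R"
  shows "\<bar>det M\<bar> * r ^ CARD('n) \<le> R ^ CARD('n)"
proof -
  let ?V = "unit_ball_vol (real CARD('n))"
  have image: "(*v) M ` cball 0 r \<in> lmeasurable \<and>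
      measure lebesgue ((*v) M ` cball 0 r) = \<bar>det M\<bar> * measure lebesgue (cball (0::real ^ 'n) r)"
    by (rule measure_matrix_image) simp
  have "(*v) M ` cball 0 r \<subseteq> cball 0 R"
    using bound by auto
  then have "measure lebesgue ((*v) M ` cball 0 r) \<le> measure lebesgue (cball (0::real ^ 'n) R)"
    using image by (intro measure_mono_fmeasurable) auto
  then have "?V * (\<bar>det M\<bar> * r ^ CARD('n)) \<le> ?V * R ^ CARD('n)"
    using image assms by (simp add: content_cball mult_ac)
  then show ?thesis
    by (simp add: mult_le_cancel_left_pos)
qed

lemma powr_inverse_power:
  fixes x :: real
  assumes "x \<ge> 0" and "n > 0"
  shows "(x powr (1 / n)) ^ n = x"
proof (cases "x = 0")
  case False
  then have "(x powr (1 / n)) ^ n = x powr (1 / n * n)"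
    using assms by (simp add: powr_realpow[symmetric] powr_powr)
  then show ?thesis
    using assms by simp
qed (use assms in simp)

lemma det_root_mult_le_if_affine_image_cball_subset:
  fixes M :: "real ^ 'n ^ 'n"
  assumes "r \<ge> 0" and bound: "\<And>u. norm u \<le> r \<Longrightarrow> norm (M *v u + b) \<le> R"
  shows "\<bar>det M\<bar> powr (1 / CARD('n)) * r \<le> R"
proof -
  have "norm b \<le> R"
    using bound[of 0] assms by simp
  then have "R \<ge> 0"
    by (rule order_trans[OF norm_ge_zero])
  have "norm (M *v u) \<le> R" if "norm u \<le> r" for u
  proof -
    have "2 * norm (M *v u) = norm ((M *v u + b) - (M *v (- u) + b))"
      by (simp add: linear_neg flip: scaleR_2)
    also have "\<dots> \<le> norm (M *v u + b) + norm (M *v (- u) + b)"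
      by (rule norm_triangle_ineq4)
    finally show ?thesis
      using bound[of u] bound[of "- u"] that by simp
  qed
  then have "\<bar>det M\<bar> * r ^ CARD('n) \<le> R ^ CARD('n)"
    by (rule abs_det_le_if_cball_image_subset[OF \<open>r \<ge> 0\<close> \<open>R \<ge> 0\<close>])
  moreover have "(\<bar>det M\<bar> powr (1 / CARD('n))) ^ CARD('n) = \<bar>det M\<bar>"
    by (simp add: powr_inverse_power)
  ultimately have "(\<bar>det M\<bar> powr (1 / CARD('n)) * r) ^ CARD('n) \<le> R ^ CARD('n)"
    by (simp add: power_mult_distrib)
  then show ?thesis
    using power_mono_iff[of "\<bar>det M\<bar> powr (1 / CARD('n)) * r" R "CARD('n)"] \<open>R \<ge> 0\<close> assms
    by simp
qed

lemma closed_subset_cball_eq_if_measure_eq: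
  fixes K :: "(real ^ 'n) set"
  assumes "closed K" and "K \<subseteq> cball 0 R" and "R > 0" and "K \<in> lmeasurable"
    and "measure lebesgue K = measure lebesgue (cball (0::real ^ 'n) R)"
  shows "K = cball 0 R"
proof -
  have "measure lebesgue (cball 0 R - K) = 0"
    using assms by (simp add: measurable_measure_Diff fmeasurableD)
  then have "negligible (cball 0 R - K)"
    using assms by (simp add: negligible_iff_measure fmeasurable_Diff fmeasurableD)
  then have "negligible (ball 0 R - K)"
    by (rule negligible_subset) auto
  moreover have "open (ball 0 R - K)"
    using \<open>closed K\<close> by (intro open_Diff) auto
  ultimately have "ball 0 R \<subseteq> K"
    using open_not_negligible by blast
  then have "closure (ball 0 R) \<subseteq> K"
    using \<open>closed K\<close> by (rule closure_minimal)
  with assms show ?thesis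
    by auto
qed

lemma affine_image_cball_eq_cball:
  fixes M :: "real ^ 'n ^ 'n"
  assumes "g > 0" and "r > 0" and det: "\<bar>det M\<bar> = g ^ CARD('n)"
    and bound: "\<And>u. norm u \<le> r \<Longrightarrow> norm (M *v u + b) \<le> g * r"
  shows "(\<lambda>u. M *v u + b) ` cball 0 r = cball 0 (g * r)"
proof (rule closed_subset_cball_eq_if_measure_eq)
  let ?K = "(\<lambda>u. M *v u + b) ` cball 0 r"
  have K: "?K = (+) b ` ((*v) M ` cball 0 r)"
    by (auto simp: image_image add.commute)
  have "compact ?K"
    by (intro compact_continuous_image continuous_intros) auto
  then show "closed ?K" and "?K \<in> lmeasurable"
    by (auto intro: compact_imp_closed lmeasurable_compact)
  show "?K \<subseteq> cball 0 (g * r)"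
    using bound by auto
  have "measure lebesgue ?K = \<bar>det M\<bar> * measure lebesgue (cball (0::real ^ 'n) r)"
    unfolding K measure_translation by (rule conjunct2[OF measure_matrix_image]) simp
  also have "\<dots> = measure lebesgue (cball (0::real ^ 'n) (g * r))"
    using assms by (simp add: content_cball power_mult_distrib)
  finally show "measure lebesgue ?K = measure lebesgue (cball (0::real ^ 'n) (g * r))" .
qed (use assms in simp)

lemma scaled_isometry_if_affine_image_cball_subset:
  fixes M :: "real ^ 'n ^ 'n"
  assumes "g > 0" and "r > 0" and det: "\<bar>det M\<bar> = g ^ CARD('n)"
    and bound: "\<And>u. norm u \<le> r \<Longrightarrow> norm (M *v u + b) \<le> g * r"
  shows "b = 0" and "norm (M *v v) = g * norm v"
proof -
  have onto: "\<exists>u. norm u \<le> r \<and> w = M *v u + b" if "norm w = g * r" for w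
    using affine_image_cball_eq_cball[OF assms] that by (force simp: dist_norm)
  show b: "b = 0"
  proof (rule ccontr)
    assume "b \<noteq> 0"
    then obtain u where u: "norm u \<le> r" and w: "- ((g * r / norm b) *\<^sub>R b) = M *v u + b"
      using onto[of "- ((g * r / norm b) *\<^sub>R b)"] assms by auto
    from w have "M *v u = - ((g * r / norm b) *\<^sub>R b) - b"
      by (simp add: algebra_simps)
    then have "M *v (- u) + b = (2 + g * r / norm b) *\<^sub>R b"
      by (simp add: linear_neg scaleR_add_left scaleR_2)
    then have "norm (M *v (- u) + b) = 2 * norm b + g * r"
      using \<open>b \<noteq> 0\<close> assms by (simp add: field_simps)
    with bound[of "- u"] u \<open>b \<noteq> 0\<close> show False
      by simp
  qed
  show "norm (M *v v) = g * norm v"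
  proof (cases "v = 0")
    case False
    let ?s = "r / norm v"
    have "norm (M *v (?s *\<^sub>R v)) \<le> g * r"
      using bound[of "?s *\<^sub>R v"] b assms False by simp
    then have upper: "norm (M *v v) \<le> g * norm v"
      using assms False by (simp add: matrix_vector_mult_scaleR field_simps)
    have "det M \<noteq> 0"
      using det assms by auto
    then have "inj ((*v) M)"
      using det_nz_iff_inj[of "(*v) M"] by simp
    then have "M *v v \<noteq> 0"
      using False by (metis injD matrix_vector_mult_0_right)
    then obtain u where u: "norm u \<le> r" and "(g * r / norm (M *v v)) *\<^sub>R (M *v v) = M *v u"
      using onto[of "(g * r / norm (M *v v)) *\<^sub>R (M *v v)"] assms b by auto
    then have "u = (g * r / norm (M *v v)) *\<^sub>R v"
      using \<open>inj ((*v) M)\<close> by (simp add: matrix_vector_mult_scaleR injD)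
    with u have "g * norm v \<le> norm (M *v v)"
      using assms \<open>M *v v \<noteq> 0\<close> by (simp add: field_simps)
    with upper show ?thesis
      by simp
  qed simp
qed

section \<open>Gram matrices\<close>

lemma inner_axis_matrix_vector_axis:
  fixes Q :: "real ^ 'n ^ 'n"
  shows "axis i 1 \<bullet> (Q *v axis j 1) = Q $ i $ j"
  by (simp add: matrix_vector_mult_basis inner_commute[of "axis i 1"]
      cart_eq_inner_axis[symmetric] column_def)

lemma psd_matrix_eq_0_if_trace_nonpos:
  fixes Q :: "real ^ 'n ^ 'n"
  assumes sym: "\<And>i j. Q $ i $ j = Q $ j $ i" and psd: "\<And>x. 0 \<le> x \<bullet> (Q *v x)"
    and trace: "(\<Sum>j\<in>UNIV. Q $ j $ j) \<le> 0"
  shows "Q = 0"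
proof -
  have "0 \<le> Q $ j $ j" for j
    using psd[of "axis j 1"] by (simp add: inner_axis_matrix_vector_axis)
  then have diag: "Q $ j $ j = 0" for j
    using trace sum_nonneg_eq_0_iff[of UNIV "\<lambda>j. Q $ j $ j"] by (simp add: antisym sum_nonneg)
  have "Q $ i $ j = 0" if "i \<noteq> j" for i j
  proof -
    have "(axis i 1 + s *\<^sub>R axis j 1) \<bullet> (Q *v (axis i 1 + s *\<^sub>R axis j 1)) = 2 * s * Q $ i $ j" for s
      by (simp add: matrix_vector_right_distrib matrix_vector_mult_scaleR inner_add_left
          inner_add_right inner_axis_matrix_vector_axis diag sym[of j i])
    from this[of 1] this[of "- 1"] show ?thesis
      using psd[of "axis i 1 + 1 *\<^sub>R axis j 1"] psd[of "axis i 1 + (- 1) *\<^sub>R axis j 1"]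
      by linarith
  qed
  with diag show ?thesis
    by (metis vec_eq_iff zero_index)
qed

lemma inner_gram_matrix_vector:
  fixes C :: "real ^ 'n ^ 'm"
  shows "x \<bullet> ((transpose C ** C) *v x) = (norm (C *v x))\<^sup>2"
proof -
  have "x \<bullet> ((transpose C ** C) *v x) = x \<bullet> (transpose C *v (C *v x))"
    by (simp add: matrix_vector_mul_assoc)
  also have "\<dots> = (x v* transpose C) \<bullet> (C *v x)"
    by (rule dot_lmul_matrix[symmetric])
  finally show ?thesis
    by (simp add: power2_norm_eq_inner)
qed

lemma gram_matrix_symmetric:
  fixes C :: "real ^ 'n ^ 'm"
  shows "(transpose C ** C) $ i $ j = (transpose C ** C) $ j $ i"
  by (simp add: matrix_matrix_mult_def transpose_def mult.commute)

lemma frob_norm_nonneg: "0 \<le> frob_norm C"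
  by (simp add: frob_norm_def sum_nonneg)

lemma frob_norm_sq_eq_sum_column_norms:
  fixes C :: "real ^ 'n ^ 'm"
  shows "(frob_norm C)\<^sup>2 = (\<Sum>j\<in>UNIV. (norm (C *v axis j 1))\<^sup>2)"
proof -
  have "(frob_norm C)\<^sup>2 = (\<Sum>i\<in>UNIV. \<Sum>j\<in>UNIV. (C $ i $ j)\<^sup>2)"
    unfolding frob_norm_def by (simp add: sum_nonneg)
  also have "\<dots> = (\<Sum>j\<in>UNIV. \<Sum>i\<in>UNIV. (C $ i $ j)\<^sup>2)"
    by (rule sum.swap)
  finally show ?thesis
    by (simp add: matrix_vector_mult_basis column_def norm_vec_def L2_set_def sum_nonneg)
qed

lemma gram_eq_if_norm_ge_and_frob_norm_le:
  fixes A :: "real ^ 'n ^ 'm" and B :: "real ^ 'n ^ 'k"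
  assumes "c \<ge> 0" and ge: "\<And>x. c * norm (B *v x) \<le> norm (A *v x)"
    and le: "frob_norm A \<le> c * frob_norm B"
  shows "transpose A ** A = c\<^sup>2 *\<^sub>R (transpose B ** B)"
proof -
  define Q where "Q = transpose A ** A - c\<^sup>2 *\<^sub>R (transpose B ** B)"
  have quad: "x \<bullet> (Q *v x) = (norm (A *v x))\<^sup>2 - (c * norm (B *v x))\<^sup>2" for x
    by (simp add: Q_def matrix_vector_mult_diff_rdistrib inner_diff_right power_mult_distrib
        scaleR_matrix_vector_assoc[symmetric] inner_gram_matrix_vector)
  have "Q = 0"
  proof (rule psd_matrix_eq_0_if_trace_nonpos)
    show "Q $ i $ j = Q $ j $ i" for i j
      by (simp add: Q_def gram_matrix_symmetric[of A i j] gram_matrix_symmetric[of B i j])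
    show "0 \<le> x \<bullet> (Q *v x)" for x
      unfolding quad using ge[of x] assms by (simp add: power_mono)
    have "(\<Sum>j\<in>UNIV. Q $ j $ j) = (frob_norm A)\<^sup>2 - (c * frob_norm B)\<^sup>2"
      by (simp add: inner_axis_matrix_vector_axis[symmetric] quad frob_norm_sq_eq_sum_column_norms
          sum_subtractf sum_distrib_left power_mult_distrib)
    also have "\<dots> \<le> 0"
      using power_mono[OF le frob_norm_nonneg, of 2] by simp
    finally show "(\<Sum>j\<in>UNIV. Q $ j $ j) \<le> 0" .
  qed
  then show ?thesis
    by (simp add: Q_def)
qed

lemma gram_eq_if_norm_eq:
  fixes A :: "real ^ 'n ^ 'm" and B :: "real ^ 'n ^ 'k"
  assumes "c \<ge> 0" and eq: "\<And>x. norm (A *v x) = c * norm (B *v x)"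
  shows "transpose A ** A = c\<^sup>2 *\<^sub>R (transpose B ** B)"
proof (rule gram_eq_if_norm_ge_and_frob_norm_le)
  have "(frob_norm A)\<^sup>2 = (c * frob_norm B)\<^sup>2"
    by (simp add: frob_norm_sq_eq_sum_column_norms eq power_mult_distrib sum_distrib_left)
  then show "frob_norm A \<le> c * frob_norm B"
    using assms frob_norm_nonneg[of A] frob_norm_nonneg[of B] by simp
qed (use assms in simp_all)

section \<open>The equality case\<close>

lemma det_gram_powr:
  fixes B :: "real ^ 'n ^ 'n"
  shows "det (B ** transpose B) powr (1 / (2 * real CARD('n))) = \<bar>det B\<bar> powr (1 / CARD('n))"
proof -
  have "det (B ** transpose B) = \<bar>det B\<bar> powr 2"
    by (cases "det B = 0") (simp_all add: det_mul powr_realpow power2_eq_square)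
  then have "det (B ** transpose B) powr (1 / (2 * real CARD('n)))
      = \<bar>det B\<bar> powr (2 * (1 / (2 * real CARD('n))))"
    by (simp only: powr_powr)
  then show ?thesis
    by simp
qed

lemma scaled_orthogonal_factor_mult_transpose:
  fixes B M :: "real ^ 'n ^ 'n"
  assumes "transpose M ** M = c *\<^sub>R mat 1" and "c \<noteq> 0"
  shows "(B ** M) ** transpose (B ** M) = c *\<^sub>R (B ** transpose B)"
proof -
  have "((1 / c) *\<^sub>R transpose M) ** M = mat 1"
    using assms by (simp add: scalar_matrix_assoc[symmetric])
  then have "M ** ((1 / c) *\<^sub>R transpose M) = mat 1"
    by (rule matrix_left_right_inverse[THEN iffD2])
  then have "(1 / c) *\<^sub>R (M ** transpose M) = mat 1"
    by (simp add: matrix_scalar_ac scalar_matrix_assoc)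
  then have "c *\<^sub>R ((1 / c) *\<^sub>R (M ** transpose M)) = c *\<^sub>R mat 1"
    by (rule arg_cong)
  then have "M ** transpose M = c *\<^sub>R mat 1"
    using assms by simp
  then show ?thesis
    by (simp add: matrix_transpose_mul matrix_mul_assoc matrix_scalar_ac scalar_matrix_assoc
        flip: matrix_mul_assoc[of B M])
qed

lemma abs_det_mult_left_inverse:
  fixes P B C :: "real ^ 'n ^ 'n"
  assumes "P ** B = mat 1"
  shows "\<bar>det (P ** C)\<bar> = \<bar>det C\<bar> / \<bar>det B\<bar>"
proof -
  have "det B * det P = 1"
    using assms by (metis det_mul det_I mult.commute)
  then have "det P = inverse (det B)"
    by (metis inverse_unique)
  then show ?thesis
    by (simp add: det_mul abs_mult divide_inverse mult.commute)
qed

lemma frob_norm_eq_if_det_weights_eq: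
  fixes Bo Bi :: "real ^ 'n ^ 'n" and Co Ci :: "real ^ 'm ^ 'k"
  assumes "det Bo \<noteq> 0"
    and "det (Bo ** transpose Bo) powr (1 / (2 * real CARD('n))) * frob_norm Co
       = det (Bi ** transpose Bi) powr (1 / (2 * real CARD('n))) * frob_norm Ci"
  shows "frob_norm Co = (\<bar>det Bi\<bar> / \<bar>det Bo\<bar>) powr (1 / CARD('n)) * frob_norm Ci"
proof -
  have "\<bar>det Bo\<bar> powr (1 / CARD('n)) * frob_norm Co = \<bar>det Bi\<bar> powr (1 / CARD('n)) * frob_norm Ci"
    using assms(2) by (simp only: det_gram_powr)
  moreover have "\<bar>det Bo\<bar> powr (1 / CARD('n)) > 0"
    using assms by simp
  ultimately show ?thesis
    by (simp add: powr_divide field_simps)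
qed

lemma affine_bound_equality_case:
  fixes M :: "real ^ 'n ^ 'n" and N :: "real ^ 'm ^ 'n"
    and Ci :: "real ^ 'm ^ 'p" and Co :: "real ^ 'm ^ 'q"
  defines "g \<equiv> \<bar>det M\<bar> powr (1 / CARD('n))"
  assumes bound: "\<And>x u. norm u \<le> norm (Ci *v x) \<Longrightarrow> norm (M *v u + N *v x) \<le> norm (Co *v x)"
    and frob: "frob_norm Co \<le> g * frob_norm Ci"
    and "det M \<noteq> 0" and "inj ((*v) Ci)"
  shows "N = 0" and "transpose M ** M = g\<^sup>2 *\<^sub>R mat 1"
    and "transpose Co ** Co = g\<^sup>2 *\<^sub>R (transpose Ci ** Ci)"
proof -
  have "g > 0"
    using \<open>det M \<noteq> 0\<close> by (simp add: g_def)
  have det: "\<bar>det M\<bar> = g ^ CARD('n)"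
    by (simp add: g_def powr_inverse_power)
  show gram: "transpose Co ** Co = g\<^sup>2 *\<^sub>R (transpose Ci ** Ci)"
  proof (rule gram_eq_if_norm_ge_and_frob_norm_le)
    show "g * norm (Ci *v x) \<le> norm (Co *v x)" for x
      unfolding g_def by (rule det_root_mult_le_if_affine_image_cball_subset[OF norm_ge_zero bound])
  qed (use \<open>g > 0\<close> frob in simp_all)
  have "norm (Co *v x) = g * norm (Ci *v x)" for x
    using arg_cong[OF gram, of "\<lambda>Q. x \<bullet> (Q *v x)"] \<open>g > 0\<close>
    by (simp add: inner_gram_matrix_vector scaleR_matrix_vector_assoc[symmetric]
        power_mult_distrib[symmetric])
  then have rigid: "N *v x = 0 \<and> (\<forall>v. norm (M *v v) = g * norm v)" if "x \<noteq> 0" for x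
    using scaled_isometry_if_affine_image_cball_subset[OF \<open>g > 0\<close> _ det, of "norm (Ci *v x)"]
      bound[of _ x] \<open>inj ((*v) Ci)\<close> that
    by (metis injD matrix_vector_mult_0_right zero_less_norm_iff)
  then have "N *v x = 0 *v x" for x
    by (cases "x = 0") auto
  then show "N = 0"
    by (rule matrix_eq[THEN iffD2, rule_format])
  show "transpose M ** M = g\<^sup>2 *\<^sub>R mat 1"
    using gram_eq_if_norm_eq[of g M "mat 1"] rigid[of 1] \<open>g > 0\<close>
    by simp
qed

theorem proposition4:
  fixes Ao Ai :: "real ^ 'nx ^ 'ny"
    and Bo Bi :: "real ^ 'ny ^ 'ny"
    and Co Ci :: "real ^ 'nx ^ 'nx"
  assumes "invertible Bo" and "invertible Bi" and "invertible Co" and "invertible Ci"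
    and "incl Ai Bi Ci \<subseteq> incl Ao Bo Co"
    and "det (Bo ** transpose Bo) powr (1 / (2 * real CARD('ny))) * frob_norm Co
       = det (Bi ** transpose Bi) powr (1 / (2 * real CARD('ny))) * frob_norm Ci"
  shows "Ao = Ai \<and> (\<exists>l>0. l *\<^sub>R (Bo ** transpose Bo) = Bi ** transpose Bi \<and>
           transpose Co ** Co = l *\<^sub>R (transpose Ci ** Ci))"
proof -
  obtain P where P: "Bo ** P = mat 1" "P ** Bo = mat 1"
    using \<open>invertible Bo\<close> unfolding invertible_def by blast
  define g where "g = \<bar>det (P ** Bi)\<bar> powr (1 / CARD('ny))"
  have detM: "\<bar>det (P ** Bi)\<bar> = \<bar>det Bi\<bar> / \<bar>det Bo\<bar>"
    using P(2) by (rule abs_det_mult_left_inverse)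
  moreover have "det Bo \<noteq> 0" and "det Bi \<noteq> 0"
    using \<open>invertible Bo\<close> \<open>invertible Bi\<close> invertible_det_nz by blast+
  ultimately have "\<bar>det (P ** Bi)\<bar> > 0"
    by simp
  then have "det (P ** Bi) \<noteq> 0" and "g > 0"
    by (simp_all add: g_def)
  have frob: "frob_norm Co = g * frob_norm Ci"
    unfolding g_def detM using \<open>det Bo \<noteq> 0\<close> assms(6) by (rule frob_norm_eq_if_det_weights_eq)
  note equality = affine_bound_equality_case[of Ci "P ** Bi" "P ** (Ai - Ao)" Co, folded g_def,
      OF incl_subset_imp_real_affine_bound[OF assms(5) P(2)] frob[THEN eq_refl]
      \<open>det (P ** Bi) \<noteq> 0\<close> inj_matrix_vector_mult[OF \<open>invertible Ci\<close>]]
  have "Bo ** (P ** (Ai - Ao)) = Ai - Ao" and BoM: "Bo ** (P ** Bi) = Bi"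
    by (metis P(1) matrix_mul_assoc matrix_mul_lid)+
  with equality(1) have "Ao = Ai"
    by simp
  moreover have "Bi ** transpose Bi = g\<^sup>2 *\<^sub>R (Bo ** transpose Bo)"
    using scaled_orthogonal_factor_mult_transpose[OF equality(2), of Bo] BoM \<open>g > 0\<close>
    by simp
  ultimately show ?thesis
    using equality(3) \<open>g > 0\<close> by (metis zero_less_power)
qed

end
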